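(* Let $\lambda>0$, let $\mathbf s_3=\{\tilde{\mathbf d}_3,\mathbf d_3,\mathbf h_3\}$ be a minimizer of (P3), fix a time $t$, and let $(\tilde{\mathbf d}_3^t,\mathbf d_3^t)$ be the subvectors of $(\tilde{\mathbf d}_3,\mathbf d_3)$ corresponding to time $t$. Suppose that every undirected cycle in $(\mathcal M,\mathcal P(\mathbf d_3^t))$ constitutes a ring $\mathcal R$, rooted at some node $m$, such that: all nodes incident to $\mathcal R$ have an identical minimum pressure limit $\underline h$; all nodes incident to $\mathcal R$ other than $m$ host no tanks or reservoirs; and no edge of $\mathcal R$ is a pump. Then the linear system $\mathbf A(\mathbf d_3^t)\mathbf h^t=\mathbf b(\tilde{\mathbf d}_3^t,\mathbf d_3^t)$ in the unknown $\mathbf h^t$ is consistent.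
   Context: Network data. A water distribution system is a finite directed graph $\mathcal G=(\mathcal M,\mathcal P)$ without self-loops, such that $(m,n)\in\mathcal P$ implies $(n,m)\notin\mathcal P$; the edge directions are arbitrary reference directions, and $P=|\mathcal P|$. $\mathcal M_r\subset\mathcal M$ (reservoirs) and $\mathcal M_b\subset\mathcal M$ (tanks) are disjoint. $\mathcal P_a\subset\mathcal P$ is the set of edges that are (ideal, fixed-speed) pumps; $\bar{\mathcal P}_a=\mathcal P\setminus\mathcal P_a$ is the set of lossy pipes. Times are $t=1,\dots,T$. Given real data: injections $d_m^t\le 0$ for $m\notin\mathcal M_r\cup\mathcal M_b$ (consumer demands); minimum pressures $\underline h_m$ ($m\in\mathcal M$); loss coefficients $c_{mn}>0$ for $(m,n)\in\bar{\mathcal P}_a$; for pumps $(m,n)\in\mathcal P_a$: pressure gains $g_{mn}\ge 0$, flow limits $0\le\underline d_{mn}\le\overline d_{mn}$, and electricity coefficients $c_{mn}$; reservoir pressures $\bar h_m$ ($m\in\mathcal M_r$); for tanks $m\in\mathcal M_b$: areas $A_m>0$, level limits $\underline\ell_m\le\overline\ell_m$, initial levels $\ell_m^0$; a period length $\delta>0$; prices $\pi_t$. Variables (for all $t$): pressures $h_m^t$ ($m\in\mathcal M$); injections $d_m^t$ ($m\in\mathcal M_r\cup\mathcal M_b$); flows $d_{mn}^t$ ($(m,n)\in\mathcal P$); pump flows $\tilde d_{mn}^t$ ($(m,n)\in\mathcal P_a$); tank variables $\tilde h_m^t,\ell_m^t$ ($m\in\mathcal M_b$); binaries $x_{mn}^t\in\{0,1\}$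 ($(m,n)\in\mathcal P$), $\alpha_m^t\in\{0,1\}$ ($m\in\mathcal M_r\cup\mathcal M_b$), $\beta_m^t\in\{0,1\}$ ($m\in\mathcal M_b$). The vectors $\tilde{\mathbf d},\mathbf d,\mathbf h$ collect all pump flows $\tilde d_{mn}^t$, all flows $d_{mn}^t$ over $\mathcal P$, and all pressures $h_m^t$; superscript $t$ on a vector denotes its entries at time $t$. Constraints (for all $t$), with on/off (big-$M$) constraints written in logical form: - conservation: $d_m^t=\sum_{k:(m,k)\in\mathcal P}d_{mk}^t-\sum_{k:(k,m)\in\mathcal P}d_{km}^t$ for all $m\in\mathcal M$; - minimum pressure: $h_m^t\ge\underline h_m$ for all $m$; - pumps $(m,n)\in\mathcal P_a$: $h_m^t-h_n^t=-g_{mn}x_{mn}^t$; $\underline d_{mn}x_{mn}^t\le\tilde d_{mn}^t\le\overline d_{mn}x_{mn}^t$; and if $x_{mn}^t=1$ then $d_{mn}^t=\tilde d_{mn}^t$; - reservoirs $m\in\mathcal M_r$: $d_m^t\ge0$; if $\alpha_m^t=0$ then $d_m^t=0$; if $\alpha_m^t=1$ then $h_m^t\le\bar h_m$; - tanks $m\in\mathcal M_b$: $\ell_m^t=\ell_m^{t-1}-d_m^t\delta/A_m$; $\underline\ell_m\le\ell_m^t\le\overline\ell_m$; $\ell_m^T=\ell_m^0$; if $\alpha_m^t=1$ then $\tilde h_m^t=h_m^t$; if $\alpha_m^t=0$ then $d_m^t=0$; if $\beta_m^t=1$ then $d_m^t\le0$ and $\tilde h_m^t\ge\overline\ell_m$;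 if $\beta_m^t=0$ then $d_m^t\ge0$ and $\tilde h_m^t\le\ell_m^t$; - relaxed pressure drop for lossy pipes $(m,n)\in\bar{\mathcal P}_a$: if $x_{mn}^t=1$ then $d_{mn}^t\ge0$ and $h_m^t-h_n^t\ge c_{mn}(d_{mn}^t)^2$; if $x_{mn}^t=0$ then $d_{mn}^t\le0$ and $h_n^t-h_m^t\ge c_{mn}(d_{mn}^t)^2$. Problem (P3): minimize $f(\tilde{\mathbf d})+\lambda g(\mathbf h)$ subject to all the constraints above, where $f(\tilde{\mathbf d})=\sum_{t=1}^T\sum_{(m,n)\in\mathcal P_a}c_{mn}\pi_t\tilde d_{mn}^t$ and $g(\mathbf h)=\sum_{t=1}^T\sum_{(m,n)\in\bar{\mathcal P}_a}|h_m^t-h_n^t|$. A minimizer is identified with its components $\{\tilde{\mathbf d},\mathbf d,\mathbf h\}$. Matrix $\mathbf A(\mathbf d^t)$: the $P\times|\mathcal M|$ matrix whose row for $(m,n)\in\mathcal P$ has entry $+1$ at $m$ and $-1$ at $n$ if $d_{mn}^t\ge0$, entry $-1$ at $m$ and $+1$ at $n$ if $d_{mn}^t<0$, and zeros elsewhere. Vector $\mathbf b(\tilde{\mathbf d}^t,\mathbf d^t)$: its entry for a lossy pipe $(m,n)$ is $c_{mn}(d_{mn}^t)^2$; its entry for a pump $(m,n)$ is $-g_{mn}\,\mathrm{sign}(\tilde d_{mn}^t)$, with $\mathrm{sign}(0)=0$. Directed flow graph $(\mathcal M,\mathcal P(\mathbf d^t))$: each edge $(m,n)\in\mathcal P$ is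 directed from $m$ to $n$ if $d_{mn}^t\ge0$, and from $n$ to $m$ otherwise. An undirected cycle is a cycle of the underlying undirected graph (a sequence of adjacent edges without repetition that starts and ends at the same node). A ring is (the edge set of) a cycle all but one of whose nodes have degree two in the undirected graph; its root is the remaining node. *)

theory Defs
  imports Complex_Main "Graph_Theory.Digraph_Component"
begin

section \<open>Network data\<close>

record 'm water_network =
  topology :: "'m pair_pre_digraph"
  reservoirs :: "'m set"
  tanks :: "'m set"
  pumps :: "('m \<times> 'm) set"
  horizon :: nat
  demand :: "nat \<Rightarrow> 'm \<Rightarrow> real"
  min_pressure :: "'m \<Rightarrow> real"
  loss_coeff :: "'m \<times> 'm \<Rightarrow> real"
  pump_gain :: "'m \<times> 'm \<Rightarrow> real"
  pump_flow_min :: "'m \<times> 'm \<Rightarrow> real"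
  pump_flow_max :: "'m \<times> 'm \<Rightarrow> real"
  pump_elec :: "'m \<times> 'm \<Rightarrow> real"
  reservoir_pressure :: "'m \<Rightarrow> real"
  tank_area :: "'m \<Rightarrow> real"
  level_min :: "'m \<Rightarrow> real"
  level_max :: "'m \<Rightarrow> real"
  initial_level :: "'m \<Rightarrow> real"
  period :: real
  price :: "nat \<Rightarrow> real"

abbreviation nodes :: "'m water_network \<Rightarrow> 'm set" where
  "nodes N \<equiv> pverts (topology N)"

abbreviation edges :: "'m water_network \<Rightarrow> ('m \<times> 'm) set" where
  "edges N \<equiv> parcs (topology N)"

abbreviation lossy_pipes :: "'m water_network \<Rightarrow> ('m \<times> 'm) set" where
  "lossy_pipes N \<equiv> edges N - pumps N"

text \<open>
  The locale predicate \<open>pair_digraph\<close> says that the graph is finite, has its edge endpoints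
  among its nodes, and has no self-loops. Injections are positive into the network, so
  consumer demands are nonpositive; \<open>demand\<close> is only used outside reservoirs and tanks.
\<close>

definition valid_network :: "'m water_network \<Rightarrow> bool" where
  "valid_network N \<longleftrightarrow>
     pair_digraph (topology N) \<and>
     (\<forall>m n. (m, n) \<in> edges N \<longrightarrow> (n, m) \<notin> edges N) \<and>
     reservoirs N \<subseteq> nodes N \<and> tanks N \<subseteq> nodes N \<and> reservoirs N \<inter> tanks N = {} \<and>
     pumps N \<subseteq> edges N \<and>
     (\<forall>t\<in>{1..horizon N}. \<forall>m\<in>nodes N - (reservoirs N \<union> tanks N). demand N t m \<le> 0) \<and>
     (\<forall>e\<in>lossy_pipes N. 0 < loss_coeff N e) \<and>
     (\<forall>e\<in>pumps N. 0 \<le> pump_gain N e \<and>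
        0 \<le> pump_flow_min N e \<and> pump_flow_min N e \<le> pump_flow_max N e) \<and>
     (\<forall>m\<in>tanks N. 0 < tank_area N m \<and> level_min N m \<le> level_max N m) \<and>
     0 < period N"


section \<open>The relaxed scheduling problem\<close>

text \<open>
  Decision variables, indexed first by time. Values outside the index sets of the problem
  are unconstrained and irrelevant. Binary variables are reals constrained to \<open>{0, 1}\<close>.
\<close>

record 'm schedule =
  pressure :: "nat \<Rightarrow> 'm \<Rightarrow> real"
  injection :: "nat \<Rightarrow> 'm \<Rightarrow> real"
  flow :: "nat \<Rightarrow> 'm \<times> 'm \<Rightarrow> real"
  pump_flow :: "nat \<Rightarrow> 'm \<times> 'm \<Rightarrow> real"
  tank_pressure :: "nat \<Rightarrow> 'm \<Rightarrow> real"
  level :: "nat \<Rightarrow> 'm \<Rightarrow> real"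
  edge_bin :: "nat \<Rightarrow> 'm \<times> 'm \<Rightarrow> real"
  alpha_bin :: "nat \<Rightarrow> 'm \<Rightarrow> real"
  beta_bin :: "nat \<Rightarrow> 'm \<Rightarrow> real"

definition binary_constraints :: "'m water_network \<Rightarrow> 'm schedule \<Rightarrow> nat \<Rightarrow> bool" where
  "binary_constraints N s t \<longleftrightarrow>
     (\<forall>e\<in>edges N. edge_bin s t e \<in> {0, 1}) \<and>
     (\<forall>m\<in>reservoirs N \<union> tanks N. alpha_bin s t m \<in> {0, 1}) \<and>
     (\<forall>m\<in>tanks N. beta_bin s t m \<in> {0, 1})"

text \<open>The injection is a variable at reservoirs and tanks, and given data elsewhere.\<close>

definition net_injection :: "'m water_network \<Rightarrow> 'm schedule \<Rightarrow> nat \<Rightarrow> 'm \<Rightarrow> real" where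
  "net_injection N s t m =
     (if m \<in> reservoirs N \<union> tanks N then injection s t m else demand N t m)"

definition conservation :: "'m water_network \<Rightarrow> 'm schedule \<Rightarrow> nat \<Rightarrow> bool" where
  "conservation N s t \<longleftrightarrow>
     (\<forall>m\<in>nodes N. net_injection N s t m =
        (\<Sum>k\<in>{k. (m, k) \<in> edges N}. flow s t (m, k)) -
        (\<Sum>k\<in>{k. (k, m) \<in> edges N}. flow s t (k, m)))"

definition pump_constraints :: "'m water_network \<Rightarrow> 'm schedule \<Rightarrow> nat \<Rightarrow> bool" where
  "pump_constraints N s t \<longleftrightarrow>
     (\<forall>(m, n)\<in>pumps N.
        pressure s t m - pressure s t n = - pump_gain N (m, n) * edge_bin s t (m, n) \<and>
        pump_flow_min N (m, n) * edge_bin s t (m, n) \<le> pump_flow s t (m, n) \<and>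
        pump_flow s t (m, n) \<le> pump_flow_max N (m, n) * edge_bin s t (m, n) \<and>
        (edge_bin s t (m, n) = 1 \<longrightarrow> flow s t (m, n) = pump_flow s t (m, n)))"

definition reservoir_constraints :: "'m water_network \<Rightarrow> 'm schedule \<Rightarrow> nat \<Rightarrow> bool" where
  "reservoir_constraints N s t \<longleftrightarrow>
     (\<forall>m\<in>reservoirs N.
        0 \<le> injection s t m \<and>
        (alpha_bin s t m = 0 \<longrightarrow> injection s t m = 0) \<and>
        (alpha_bin s t m = 1 \<longrightarrow> pressure s t m \<le> reservoir_pressure N m))"

definition tank_constraints :: "'m water_network \<Rightarrow> 'm schedule \<Rightarrow> nat \<Rightarrow> bool" where
  "tank_constraints N s t \<longleftrightarrow>
     (\<forall>m\<in>tanks N.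
        level s t m = level s (t - 1) m - injection s t m * period N / tank_area N m \<and>
        level_min N m \<le> level s t m \<and> level s t m \<le> level_max N m \<and>
        (alpha_bin s t m = 1 \<longrightarrow> tank_pressure s t m = pressure s t m) \<and>
        (alpha_bin s t m = 0 \<longrightarrow> injection s t m = 0) \<and>
        (beta_bin s t m = 1 \<longrightarrow> injection s t m \<le> 0 \<and> level_max N m \<le> tank_pressure s t m) \<and>
        (beta_bin s t m = 0 \<longrightarrow> 0 \<le> injection s t m \<and> tank_pressure s t m \<le> level s t m))"

definition pipe_constraints :: "'m water_network \<Rightarrow> 'm schedule \<Rightarrow> nat \<Rightarrow> bool" where
  "pipe_constraints N s t \<longleftrightarrow>
     (\<forall>(m, n)\<in>lossy_pipes N.
        (edge_bin s t (m, n) = 1 \<longrightarrow> 0 \<le> flow s t (m, n) \<and>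
           pressure s t m - pressure s t n \<ge> loss_coeff N (m, n) * (flow s t (m, n))\<^sup>2) \<and>
        (edge_bin s t (m, n) = 0 \<longrightarrow> flow s t (m, n) \<le> 0 \<and>
           pressure s t n - pressure s t m \<ge> loss_coeff N (m, n) * (flow s t (m, n))\<^sup>2))"

text \<open>
  Levels carry the extra index \<open>0\<close>, which is fixed to the initial level.
\<close>

definition feasible :: "'m water_network \<Rightarrow> 'm schedule \<Rightarrow> bool" where
  "feasible N s \<longleftrightarrow>
     (\<forall>t\<in>{1..horizon N}.
        binary_constraints N s t \<and>
        conservation N s t \<and>
        (\<forall>m\<in>nodes N. min_pressure N m \<le> pressure s t m) \<and>
        pump_constraints N s t \<and>
        reservoir_constraints N s t \<and>
        tank_constraints N s t \<and>
        pipe_constraints N s t) \<and>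
     (\<forall>m\<in>tanks N. level s 0 m = initial_level N m \<and>
        level s (horizon N) m = initial_level N m)"

definition pumping_cost :: "'m water_network \<Rightarrow> (nat \<Rightarrow> 'm \<times> 'm \<Rightarrow> real) \<Rightarrow> real" where
  "pumping_cost N dp = (\<Sum>t=1..horizon N. \<Sum>e\<in>pumps N. pump_elec N e * price N t * dp t e)"

definition pressure_penalty :: "'m water_network \<Rightarrow> (nat \<Rightarrow> 'm \<Rightarrow> real) \<Rightarrow> real" where
  "pressure_penalty N h = (\<Sum>t=1..horizon N. \<Sum>(m, n)\<in>lossy_pipes N. \<bar>h t m - h t n\<bar>)"

text \<open>
  A minimizer is given by its pump flows, flows and pressures; the other variables are
  existentially quantified.
\<close>

definition P3_minimizer ::
  "'m water_network \<Rightarrow> real \<Rightarrow> (nat \<Rightarrow> 'm \<times> 'm \<Rightarrow> real) \<Rightarrow> (nat \<Rightarrow> 'm \<times> 'm \<Rightarrow> real)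
     \<Rightarrow> (nat \<Rightarrow> 'm \<Rightarrow> real) \<Rightarrow> bool" where
  "P3_minimizer N lam dp d h \<longleftrightarrow>
     (\<exists>s. is_arg_min
            (\<lambda>s. pumping_cost N (pump_flow s) + lam * pressure_penalty N (pressure s))
            (feasible N) s \<and>
          pump_flow s = dp \<and> flow s = d \<and> pressure s = h)"


section \<open>The pressure equations at a single time\<close>

text \<open>Rows are indexed by the edges and columns by the nodes.\<close>

fun flow_matrix :: "('m \<times> 'm \<Rightarrow> real) \<Rightarrow> 'm \<times> 'm \<Rightarrow> 'm \<Rightarrow> real" where
  "flow_matrix d (m, n) k =
     (if k = m then (if 0 \<le> d (m, n) then 1 else - 1)
      else if k = n then (if 0 \<le> d (m, n) then - 1 else 1)
      else 0)"

definition drop_vector ::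
  "'m water_network \<Rightarrow> ('m \<times> 'm \<Rightarrow> real) \<Rightarrow> ('m \<times> 'm \<Rightarrow> real) \<Rightarrow> 'm \<times> 'm \<Rightarrow> real" where
  "drop_vector N dp d e =
     (if e \<in> pumps N then - pump_gain N e * sgn (dp e) else loss_coeff N e * (d e)\<^sup>2)"

definition consistent_pressures ::
  "'m water_network \<Rightarrow> ('m \<times> 'm \<Rightarrow> real) \<Rightarrow> ('m \<times> 'm \<Rightarrow> real) \<Rightarrow> bool" where
  "consistent_pressures N dp d \<longleftrightarrow>
     (\<exists>h :: 'm \<Rightarrow> real. \<forall>e\<in>edges N. (\<Sum>k\<in>nodes N. flow_matrix d e k * h k) = drop_vector N dp d e)"


section \<open>Undirected cycles and rings\<close>

definition flow_graph :: "'m water_network \<Rightarrow> ('m \<times> 'm \<Rightarrow> real) \<Rightarrow> 'm pair_pre_digraph" where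
  "flow_graph N d =
     \<lparr> pverts = nodes N, parcs = (\<lambda>(m, n). if 0 \<le> d (m, n) then (m, n) else (n, m)) ` edges N \<rparr>"

text \<open>
  The underlying undirected graph is the symmetric closure \<open>mk_symmetric\<close>, in which the
  library notion of cycle still admits going along an edge and straight back. Distinctness
  of the unordered edges excludes this.
\<close>

definition undirected_cycle :: "'m pair_pre_digraph \<Rightarrow> ('m \<times> 'm) list \<Rightarrow> bool" where
  "undirected_cycle H p \<longleftrightarrow>
     pre_digraph.cycle (with_proj (mk_symmetric (with_proj H))) p \<and>
     distinct (map (\<lambda>(u, v). {u, v}) p)"

definition cycle_nodes :: "('m \<times> 'm) list \<Rightarrow> 'm set" where
  "cycle_nodes p = fst ` set p"

text \<open>
  In a symmetric digraph the out-degree of a node is its undirected degree. The degree of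
  the root is left open, so a connected component that is itself a cycle is also a ring.
\<close>

definition ring_rooted_at :: "'m pair_pre_digraph \<Rightarrow> ('m \<times> 'm) list \<Rightarrow> 'm \<Rightarrow> bool" where
  "ring_rooted_at H p m \<longleftrightarrow>
     undirected_cycle H p \<and> m \<in> cycle_nodes p \<and>
     (\<forall>v\<in>cycle_nodes p - {m}. out_degree (with_proj (mk_symmetric (with_proj H))) v = 2)"

end

theory Submission
  imports Defs
begin

text \<open>
  Multiplying each row by the sign of its flow turns the linear system into prescribed pressure
  differences on the edges. Such differences come from a potential as soon as they add up to zero
  around every simple cycle (\<open>potential_exists\<close>). Edges on no cycle impose no condition; this
  covers all pumps, since every cycle is a ring without pumps. What is left is to show that in a
  minimizer the losses \<open>c * d * \<bar>d\<bar>\<close> balance around each ring (\<open>ring_drops_balance\<close>).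

  Only the flows of the minimizer have to be balanced; its pressures may exceed the losses and
  need not solve the system. Suppose the losses around a ring do not balance. Inner ring nodes
  have degree two and only consume, so the flow, measured along the ring from the root, is
  decreasing: two streams leave the root and meet. Adding a circulation \<open>\<kappa>\<close> to the ring
  preserves conservation and all injections, and for a suitable \<open>\<kappa>\<close> the losses balance. Now let
  the pressures drop from the root by exactly these losses. For a balanced flow the total absolute
  drop is twice the loss of one stream, whereas any admissible pressures have a total absolute drop
  of at least twice the loss of either stream of the flow that they carry. Moving away from balance
  increases the loss of one of the streams, so the balanced ring has a strictly smaller penalty
  (\<open>unbalanced_ring_improvement\<close>). Its lowest pressure is not below the lowest original one, and
  all ring nodes have the same limit, so it is feasible
  (\<open>feasible_modify_schedule\<close>). Pump flows, and with them the pumping cost, are the same. This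
  contradicts minimality.
\<close>

section \<open>Closed walks\<close>

lemma pcas_append: "pcas u (p @ q) v \<longleftrightarrow> (\<exists>w. pcas u p w \<and> pcas w q v)"
  by (induction p arbitrary: u) auto

lemma pawalk_verts_conv_snd: "pcas u p v \<Longrightarrow> pawalk_verts u p = u # map snd p"
  by (induction p arbitrary: u) auto

text \<open>
  Each node of a walk is left as often as it is entered, up to the two end points. For a closed
  walk this turns distinctness of the heads into distinctness of the tails.
\<close>

lemma pcas_endpoints_mset:
  "pcas u p v \<Longrightarrow> add_mset v (mset (map fst p)) = add_mset u (mset (map snd p))"
  by (induction p arbitrary: u) (auto simp: add_mset_commute)

lemma pcas_telescope:
  fixes h :: "'a \<Rightarrow> real"
  assumes "pcas u p v" and "\<And>x y. (x, y) \<in> set p \<Longrightarrow> W (x, y) = h x - h y"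
  shows "sum_list (map W p) = h u - h v"
  using assms
proof (induction p arbitrary: u)
  case (Cons e p)
  have "W e = h (fst e) - h (snd e)"
    using Cons.prems(2)[of "fst e" "snd e"] by simp
  moreover have "sum_list (map W p) = h (snd e) - h v"
    using Cons by (intro Cons.IH) auto
  ultimately show ?case using Cons.prems(1) by simp
qed simp

text \<open>
  A path that never returns to its first node cannot use the first edge again, in either direction.
\<close>

lemma simple_path_distinct_edges:
  assumes "pcas u p v" and "distinct (u # map snd p)"
  shows "distinct (map (\<lambda>(x, y). {x, y}) p)"
  using assms
proof (induction p arbitrary: u)
  case (Cons e p)
  have "fst x \<noteq> u" "snd x \<noteq> u" if "x \<in> set p" for x
  proof -
    from Cons.prems have "pcas (snd e) p v" by simp
    from pcas_endpoints_mset[OF this] have "fst ` set p \<subseteq> insert (snd e) (snd ` set p)"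
      by (metis insert_iff set_mset_add_mset_insert set_mset_mset list.set_map subsetI)
    with that Cons.prems(2) show "fst x \<noteq> u" "snd x \<noteq> u" by auto
  qed
  then have "{fst e, snd e} \<notin> (\<lambda>(x, y). {x, y}) ` set p"
    using Cons.prems(1) by (fastforce simp: doubleton_eq_iff)
  moreover have "distinct (map (\<lambda>(x, y). {x, y}) p)"
    using Cons.prems by (intro Cons.IH) auto
  ultimately show ?case by (simp add: case_prod_unfold)
qed simp

lemma simple_path_of_rtrancl:
  assumes "(u, v) \<in> S\<^sup>*"
  obtains p where "pcas u p v" "set p \<subseteq> S" "distinct (u # map snd p)"
proof -
  interpret G: pair_wf_digraph "\<lparr>pverts = UNIV, parcs = S\<rparr>"
    by unfold_locales auto
  have "u \<rightarrow>\<^sup>*\<^bsub>with_proj \<lparr>pverts = UNIV, parcs = S\<rparr>\<^esub> v"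
    using assms by (simp add: G.reachable_conv)
  then obtain p where "G.apath u p v"
    using G.reachable_apath by blast
  then have "pcas u p v" "set p \<subseteq> S" "distinct (pawalk_verts u p)"
    by (auto simp: G.apath_def G.awalk_def)
  then show ?thesis
    using that pawalk_verts_conv_snd by metis
qed

text \<open>
  Potentials are built edge by edge. If the new edge joins two nodes that are already connected,
  a simple path between them closes up to a cycle, and the cycle condition says exactly that the
  old potential fits the new edge. Otherwise all values in one of the two components can be
  shifted by a constant without disturbing the edges treated so far. An edge on no cycle imposes
  no condition; this is how pumps are dealt with later.
\<close>

lemma potential_exists:
  fixes W :: "'a \<times> 'a \<Rightarrow> real"
  assumes "finite E"
    and antisym: "\<And>x y. W (y, x) = - W (x, y)"
    and "\<And>u p. p \<noteq> [] \<Longrightarrow> pcas u p u \<Longrightarrow> set p \<subseteq> E \<union> E\<inverse> \<Longrightarrow> distinct (map snd p) \<Longrightarrow>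
           distinct (map (\<lambda>(x, y). {x, y}) p) \<Longrightarrow> sum_list (map W p) = 0"
  shows "\<exists>h. \<forall>(x, y)\<in>E. h x - h y = W (x, y)"
  using assms(1,3)
proof (induction E rule: finite_induct)
  case (insert e E)
  obtain a b where e: "e = (a, b)" by force
  let ?S = "E \<union> E\<inverse>"
  have "\<exists>h. \<forall>(x, y)\<in>E. h x - h y = W (x, y)"
    by (rule insert.IH, rule insert.prems) auto
  then obtain h where h: "h x - h y = W (x, y)" if "(x, y) \<in> E" for x y
    by auto
  have hS: "W (x, y) = h x - h y" if "(x, y) \<in> ?S" for x y
    using that h[of x y] h[of y x] antisym[of y x] by auto
  show ?case
  proof (cases "(b, a) \<in> ?S\<^sup>*")
    case True
    have "h a - h b = W (a, b)"
    proof (cases "(a, b) \<in> ?S")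
      case False
      obtain p where p: "pcas b p a" "set p \<subseteq> ?S" "distinct (b # map snd p)"
        using simple_path_of_rtrancl[OF \<open>(b, a) \<in> ?S\<^sup>*\<close>] .
      have "{a, b} \<notin> (\<lambda>(x, y). {x, y}) ` set p"
      proof
        assume "{a, b} \<in> (\<lambda>(x, y). {x, y}) ` set p"
        then have "(a, b) \<in> set p \<or> (b, a) \<in> set p"
          by (auto simp: doubleton_eq_iff)
        with p(2) \<open>(a, b) \<notin> ?S\<close> show False by auto
      qed
      with simple_path_distinct_edges[OF p(1,3)] p e
      have "sum_list (map W (e # p)) = 0"
        by (intro insert.prems[where u = a]) auto
      moreover have "sum_list (map W p) = h b - h a"
        using p(2) by (intro pcas_telescope[OF p(1)] hS) auto
      ultimately show ?thesis using e by simp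
    qed (use hS in auto)
    with h e show ?thesis by (intro exI[of _ h]) auto
  next
    case False
    \<comment> \<open>the component of \<open>b\<close>, and the amount by which the new edge misses its target\<close>
    define R where "R = {x. (b, x) \<in> ?S\<^sup>*}"
    define \<delta> where "\<delta> = h a - h b - W (a, b)"
    have ab: "a \<notin> R" "b \<in> R" using False by (auto simp: R_def)
    have "x \<in> R \<longleftrightarrow> y \<in> R" if "(x, y) \<in> E" for x y
    proof -
      have "(x, y) \<in> ?S" "(y, x) \<in> ?S" using that by auto
      then show ?thesis unfolding R_def by (auto intro: rtrancl_into_rtrancl)
    qed
    with h e ab show ?thesis
      by (intro exI[of _ "\<lambda>x. if x \<in> R then h x + \<delta> else h x"]) (auto simp: \<delta>_def)
  qed
qed auto

section \<open>Rebalancing the flow along a ring\<close>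

lemma antitone_below:
  fixes f :: "nat \<Rightarrow> real"
  assumes dec: "\<And>i. Suc i < k \<Longrightarrow> f (Suc i) \<le> f i" and "i \<le> j" and "j < k"
  shows "f j \<le> f i"
  using assms(2,3)
proof (induction j rule: dec_induct)
  case (step n)
  then show ?case using dec[of n] by force
qed simp

text \<open>
  The edges of a ring are numbered from the root back to the root, \<open>f i\<close> being the flow on edge
  \<open>i\<close> in this direction. Inner nodes only consume, so \<open>f\<close> decreases: the edges with
  forward flow come first. Let \<open>P x\<close> be the sum of the losses of the forward
  edges after adding the circulation \<open>x\<close>. If the balanced flow arises by a negative circulation
  \<open>\<kappa>\<close>, then \<open>P \<kappa> < P 0\<close>. The given pressures fall by at least \<open>P 0\<close> in total on the forward
  edges; they rise by as much on the rest of the closed ring, whence the second bound. The first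
  holds because the forward edges come first, so some given pressure is at most \<open>H 0 - P 0\<close>.
\<close>

lemma unbalanced_ring_outflow_bounds:
  fixes c f H :: "nat \<Rightarrow> real"
  assumes pos: "\<And>i. i < k \<Longrightarrow> 0 < c i"
    and dec: "\<And>i. Suc i < k \<Longrightarrow> f (Suc i) \<le> f i"
    and closed: "H k = H 0"
    and drop: "\<And>i. i < k \<Longrightarrow>
      0 \<le> f i \<and> c i * (f i)\<^sup>2 \<le> H i - H (Suc i) \<or>
      f i \<le> 0 \<and> c i * (f i)\<^sup>2 \<le> H (Suc i) - H i"
    and low: "\<And>i. i \<le> k \<Longrightarrow> hmin \<le> H i"
    and "0 < k"
    and "\<kappa> < 0"
    and balanced: "(\<Sum>i<k. c i * (max 0 (f i + \<kappa>))\<^sup>2) = (\<Sum>i<k. c i * (max 0 (- (f i + \<kappa>)))\<^sup>2)"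
  shows "hmin \<le> H 0 - (\<Sum>i<k. c i * (max 0 (f i + \<kappa>))\<^sup>2)"
    and "2 * (\<Sum>i<k. c i * (max 0 (f i + \<kappa>))\<^sup>2) < (\<Sum>i<k. \<bar>H i - H (Suc i)\<bar>)"
proof -
  define P where "P x = (\<Sum>i<k. c i * (max 0 (f i + x))\<^sup>2)" for x
  have f_le: "f j \<le> f i" if "i \<le> j" "j < k" for i j
    using antitone_below[of k f i j] dec that by blast
  \<comment> \<open>Strictness: without forward flow before the shift, all flows would be negative after it,
    contradicting the balance.\<close>
  have "0 < f 0"
  proof (rule ccontr)
    assume "\<not> 0 < f 0"
    then have neg: "f i + \<kappa> < 0" if "i < k" for i
      using f_le[of 0 i] that \<open>\<kappa> < 0\<close> by simp
    have "P \<kappa> = 0"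
      unfolding P_def using neg by (intro sum.neutral) (auto simp: max_def, fastforce)
    moreover have "0 < (\<Sum>i<k. c i * (max 0 (- (f i + \<kappa>)))\<^sup>2)"
    proof (intro sum_pos)
      fix i assume "i \<in> {..<k}"
      then show "0 < c i * (max 0 (- (f i + \<kappa>)))\<^sup>2"
        using pos[of i] neg[of i] by (simp add: max_def zero_less_mult_iff)
    qed (use \<open>0 < k\<close> in auto)
    ultimately show False using balanced by (simp add: P_def)
  qed
  have "P \<kappa> < P 0"
    unfolding P_def
  proof (intro sum_strict_mono_ex1 bexI[of _ 0] ballI)
    fix i assume "i \<in> {..<k}"
    then show "c i * (max 0 (f i + \<kappa>))\<^sup>2 \<le> c i * (max 0 (f i + 0))\<^sup>2"
      using pos[of i] \<open>\<kappa> < 0\<close> by (intro mult_left_mono power_mono) auto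
  next
    show "c 0 * (max 0 (f 0 + \<kappa>))\<^sup>2 < c 0 * (max 0 (f 0 + 0))\<^sup>2"
      using pos[of 0] \<open>0 < k\<close> \<open>\<kappa> < 0\<close> \<open>0 < f 0\<close>
      by (intro mult_strict_left_mono power_strict_mono) auto
  qed (use \<open>0 < k\<close> in auto)
  have drop_pos: "c i * (max 0 (f i))\<^sup>2 \<le> max 0 (H i - H (Suc i))" if "i < k" for i
    using drop[OF that] by (auto simp: max_def)
  have "2 * P 0 \<le> (\<Sum>i<k. \<bar>H i - H (Suc i)\<bar>)"
  proof -
    have "(\<Sum>i<k. H i - H (Suc i)) = 0"
      using closed by (simp add: sum_lessThan_telescope')
    then have "(\<Sum>i<k. \<bar>H i - H (Suc i)\<bar>) = (\<Sum>i<k. \<bar>H i - H (Suc i)\<bar> + (H i - H (Suc i)))"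
      by (simp add: sum.distrib)
    also have "\<dots> = 2 * (\<Sum>i<k. max 0 (H i - H (Suc i)))"
      unfolding sum_distrib_left by (intro sum.cong) (auto simp: max_def)
    also have "\<dots> \<ge> 2 * P 0"
      unfolding P_def using drop_pos by (intro mult_left_mono sum_mono) auto
    finally show ?thesis .
  qed
  with \<open>P \<kappa> < P 0\<close> show "2 * (\<Sum>i<k. c i * (max 0 (f i + \<kappa>))\<^sup>2) < (\<Sum>i<k. \<bar>H i - H (Suc i)\<bar>)"
    by (simp add: P_def)
  \<comment> \<open>the node where the forward flow ends\<close>
  define j where "j = (LEAST j. j = k \<or> f j \<le> 0)"
  have j: "j = k \<or> f j \<le> 0"
    unfolding j_def by (rule LeastI[of _ k]) simp
  have "j \<le> k" unfolding j_def by (rule Least_le) simp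
  have before: "0 < f i" if "i < j" for i
    using not_less_Least[of i "\<lambda>j. j = k \<or> f j \<le> 0"] that unfolding j_def by force
  have after: "f i \<le> 0" if "j \<le> i" "i < k" for i
    using j f_le[of j i] that by auto
  have "P 0 = (\<Sum>i<j. c i * (max 0 (f i))\<^sup>2)"
    unfolding P_def using \<open>j \<le> k\<close> after by (intro sum.mono_neutral_cong_right) auto
  also have "\<dots> \<le> (\<Sum>i<j. H i - H (Suc i))"
  proof (intro sum_mono)
    fix i assume "i \<in> {..<j}"
    then show "c i * (max 0 (f i))\<^sup>2 \<le> H i - H (Suc i)"
      using drop[of i] before[of i] \<open>j \<le> k\<close> by auto
  qed
  also have "\<dots> = H 0 - H j"
    by (simp add: sum_lessThan_telescope')
  finally have "P 0 \<le> H 0 - H j" .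
  with \<open>P \<kappa> < P 0\<close> low[OF \<open>j \<le> k\<close>]
  show "hmin \<le> H 0 - (\<Sum>i<k. c i * (max 0 (f i + \<kappa>))\<^sup>2)"
    by (simp add: P_def)
qed

text \<open>
  The signed loss around the ring is continuous in the added circulation, nonpositive when the
  largest flow is shifted to zero and nonnegative when the smallest one is, so some shift \<open>\<kappa>\<close>
  balances it. Taking all pressure drops equal to the losses of the shifted flow then beats the
  given pressures in the total absolute drop. It also keeps to the lower limit: the lowest new
  pressure, at the point where the two streams from the root meet, lies one stream's loss below
  the root, and the given pressures reach at least as far down. A positive
  \<open>\<kappa>\<close> reduces to a negative one by traversing the ring backwards.
\<close>

lemma unbalanced_ring_improvement:
  fixes c f H :: "nat \<Rightarrow> real"
  assumes pos: "\<And>i. i < k \<Longrightarrow> 0 < c i"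
    and dec: "\<And>i. Suc i < k \<Longrightarrow> f (Suc i) \<le> f i"
    and closed: "H k = H 0"
    and drop: "\<And>i. i < k \<Longrightarrow>
      0 \<le> f i \<and> c i * (f i)\<^sup>2 \<le> H i - H (Suc i) \<or>
      f i \<le> 0 \<and> c i * (f i)\<^sup>2 \<le> H (Suc i) - H i"
    and low: "\<And>i. i \<le> k \<Longrightarrow> hmin \<le> H i"
    and unbalanced: "(\<Sum>i<k. c i * (f i * \<bar>f i\<bar>)) \<noteq> 0"
  obtains \<kappa> where "(\<Sum>i<k. c i * ((f i + \<kappa>) * \<bar>f i + \<kappa>\<bar>)) = 0"
    and "\<And>j. j \<le> k \<Longrightarrow> hmin \<le> H 0 - (\<Sum>i<j. c i * ((f i + \<kappa>) * \<bar>f i + \<kappa>\<bar>))"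
    and "(\<Sum>i<k. \<bar>c i * ((f i + \<kappa>) * \<bar>f i + \<kappa>\<bar>)\<bar>) < (\<Sum>i<k. \<bar>H i - H (Suc i)\<bar>)"
proof -
  define G where "G x = (\<Sum>i<k. c i * ((f i + x) * \<bar>f i + x\<bar>))" for x
  define P where "P x = (\<Sum>i<k. c i * (max 0 (f i + x))\<^sup>2)" for x
  define Q where "Q x = (\<Sum>i<k. c i * (max 0 (- (f i + x)))\<^sup>2)" for x
  have "0 < k" using unbalanced by (cases k) auto
  have f_le: "f j \<le> f i" if "i \<le> j" "j < k" for i j
    using antitone_below[of k f i j] dec that by blast
  have "\<exists>\<kappa>. - f 0 \<le> \<kappa> \<and> \<kappa> \<le> - f (k - 1) \<and> G \<kappa> = 0"
  proof (rule IVT')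
    show "G (- f 0) \<le> 0"
      unfolding G_def
    proof (intro sum_nonpos)
      fix i assume "i \<in> {..<k}"
      then show "c i * ((f i + - f 0) * \<bar>f i + - f 0\<bar>) \<le> 0"
        using pos[of i] f_le[of 0 i] by (auto simp: mult_le_0_iff)
    qed
    show "0 \<le> G (- f (k - 1))"
      unfolding G_def
    proof (intro sum_nonneg)
      fix i assume "i \<in> {..<k}"
      then show "0 \<le> c i * ((f i + - f (k - 1)) * \<bar>f i + - f (k - 1)\<bar>)"
        using pos[of i] f_le[of i "k - 1"] by (auto simp: zero_le_mult_iff)
    qed
    show "continuous_on {- f 0..- f (k - 1)} G"
      unfolding G_def by (intro continuous_intros)
  qed (use f_le[of 0 "k - 1"] \<open>0 < k\<close> in auto)
  then obtain \<kappa> where \<kappa>: "G \<kappa> = 0" by blast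
  with unbalanced have "\<kappa> \<noteq> 0" by (auto simp: G_def)
  \<comment> \<open>forward and backward parts; for the balanced flow they are equal, so the total absolute
    drop is twice the forward part\<close>
  have split: "y * \<bar>y\<bar> = (max 0 y)\<^sup>2 - (max 0 (- y))\<^sup>2" "\<bar>y * \<bar>y\<bar>\<bar> = (max 0 y)\<^sup>2 + (max 0 (- y))\<^sup>2"
    for y :: real
    by (auto simp: max_def power2_eq_square abs_mult)
  have "G \<kappa> = P \<kappa> - Q \<kappa>"
    unfolding G_def P_def Q_def split(1) by (simp add: right_diff_distrib sum_subtractf)
  with \<kappa> have PQ: "P \<kappa> = Q \<kappa>" by simp
  have "hmin \<le> H 0 - P \<kappa> \<and> 2 * P \<kappa> < (\<Sum>i<k. \<bar>H i - H (Suc i)\<bar>)"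
  proof (cases "\<kappa> < 0")
    case True
    show ?thesis
      using unbalanced_ring_outflow_bounds[OF pos dec closed drop low \<open>0 < k\<close> True] PQ
      unfolding P_def Q_def by blast
  next
    case False
    let ?f = "\<lambda>i. - f (k - Suc i)" and ?c = "\<lambda>i. c (k - Suc i)" and ?H = "\<lambda>i. H (k - i)"
    have rev_sum: "(\<Sum>i<k. g (k - Suc i)) = (\<Sum>i<k. g i)" for g :: "nat \<Rightarrow> real"
      by (rule sum.nat_diff_reindex)
    have P: "(\<Sum>i<k. ?c i * (max 0 (- (?f i + - \<kappa>)))\<^sup>2) = P \<kappa>"
      using rev_sum[of "\<lambda>i. c i * (max 0 (f i + \<kappa>))\<^sup>2"] by (simp add: P_def algebra_simps)
    have Q: "(\<Sum>i<k. ?c i * (max 0 (?f i + - \<kappa>))\<^sup>2) = Q \<kappa>"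
      using rev_sum[of "\<lambda>i. c i * (max 0 (- (f i + \<kappa>)))\<^sup>2"] by (simp add: Q_def algebra_simps)
    have D: "(\<Sum>i<k. \<bar>?H i - ?H (Suc i)\<bar>) = (\<Sum>i<k. \<bar>H i - H (Suc i)\<bar>)"
    proof -
      have "(\<Sum>i<k. \<bar>?H i - ?H (Suc i)\<bar>) =
          (\<Sum>i<k. \<bar>H (k - Suc i) - H (Suc (k - Suc i))\<bar>)"
        by (intro sum.cong) (auto simp: Suc_diff_Suc abs_minus_commute)
      then show ?thesis using rev_sum[of "\<lambda>i. \<bar>H i - H (Suc i)\<bar>"] by simp
    qed
    have 1: "0 < ?c i" if "i < k" for i using pos that by simp
    have 2: "?f (Suc i) \<le> ?f i" if "Suc i < k" for i
      using dec[of "k - Suc (Suc i)"] that by (simp add: Suc_diff_Suc)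
    have 3: "?H k = ?H 0" using closed by simp
    have 4: "0 \<le> ?f i \<and> ?c i * (?f i)\<^sup>2 \<le> ?H i - ?H (Suc i) \<or>
        ?f i \<le> 0 \<and> ?c i * (?f i)\<^sup>2 \<le> ?H (Suc i) - ?H i" if "i < k" for i
      using drop[of "k - Suc i"] that by (auto simp: Suc_diff_Suc)
    have 5: "hmin \<le> ?H i" if "i \<le> k" for i using low by simp
    have 6: "- \<kappa> < 0" using False \<open>\<kappa> \<noteq> 0\<close> by simp
    have 7: "(\<Sum>i<k. ?c i * (max 0 (?f i + - \<kappa>))\<^sup>2) =
        (\<Sum>i<k. ?c i * (max 0 (- (?f i + - \<kappa>)))\<^sup>2)"
      unfolding P Q using PQ by simp
    note bounds = unbalanced_ring_outflow_bounds[of k ?c ?f ?H hmin "- \<kappa>",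
        OF 1 2 3 4 5 \<open>0 < k\<close> 6 7, unfolded Q D]
    show ?thesis using bounds PQ closed by simp
  qed
  moreover have "(\<Sum>i<j. c i * ((f i + \<kappa>) * \<bar>f i + \<kappa>\<bar>)) \<le> P \<kappa>" if "j \<le> k" for j
  proof -
    have "(\<Sum>i<j. c i * ((f i + \<kappa>) * \<bar>f i + \<kappa>\<bar>)) \<le> (\<Sum>i<j. c i * (max 0 (f i + \<kappa>))\<^sup>2)"
    proof (intro sum_mono)
      fix i assume "i \<in> {..<j}"
      then show "c i * ((f i + \<kappa>) * \<bar>f i + \<kappa>\<bar>) \<le> c i * (max 0 (f i + \<kappa>))\<^sup>2"
        using pos[of i] that unfolding split(1) by (intro mult_left_mono) auto
    qed
    also have "\<dots> \<le> P \<kappa>"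
      unfolding P_def using that pos by (intro sum_mono2) (auto simp: less_imp_le)
    finally show ?thesis .
  qed
  moreover have "(\<Sum>i<k. \<bar>c i * ((f i + \<kappa>) * \<bar>f i + \<kappa>\<bar>)\<bar>) = P \<kappa> + Q \<kappa>"
    unfolding P_def Q_def sum.distrib[symmetric]
    using pos by (intro sum.cong) (auto simp: abs_mult[of "c _"] split(2) distrib_left abs_of_pos)
  ultimately show ?thesis
    using \<kappa> PQ by (intro that[of \<kappa>]) (force simp: G_def)+
qed

section \<open>Flows along the edges of an oriented graph\<close>

text \<open>
  The value of a flow on an edge traversed in either direction. Being zero off the graph makes it
  antisymmetric on all pairs, as is required of the weights of a potential.
\<close>

definition oriented :: "('a \<times> 'a) set \<Rightarrow> ('a \<times> 'a \<Rightarrow> real) \<Rightarrow> 'a \<times> 'a \<Rightarrow> real" where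
  "oriented E d e =
     (if e \<in> E then d e else if prod.swap e \<in> E then - d (prod.swap e) else 0)"

definition net_outflow :: "('a \<times> 'a) set \<Rightarrow> ('a \<times> 'a \<Rightarrow> real) \<Rightarrow> 'a \<Rightarrow> real" where
  "net_outflow E d v =
     (\<Sum>k\<in>{k. (v, k) \<in> E}. d (v, k)) - (\<Sum>k\<in>{k. (k, v) \<in> E}. d (k, v))"

text \<open>
  A unit flow around the closed walk \<open>q\<close>, given in the reference directions of the edges.
\<close>

definition circulation :: "('a \<times> 'a) list \<Rightarrow> 'a \<times> 'a \<Rightarrow> real" where
  "circulation q e = of_bool (e \<in> set q) - of_bool (prod.swap e \<in> set q)"

lemma oriented_swap:
  assumes "\<And>x y. (x, y) \<in> E \<Longrightarrow> (y, x) \<notin> E"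
  shows "oriented E d (y, x) = - oriented E d (x, y)"
  using assms by (auto simp: oriented_def)

lemma finite_neighbours:
  assumes "finite E"
  shows "finite {k. (v, k) \<in> E}" "finite {k. (k, v) \<in> E}"
proof -
  have "{k. (v, k) \<in> E} \<subseteq> snd ` E" "{k. (k, v) \<in> E} \<subseteq> fst ` E" by force+
  then show "finite {k. (v, k) \<in> E}" "finite {k. (k, v) \<in> E}"
    using assms by (auto intro: finite_subset)
qed

lemma net_outflow_eq_sum_oriented:
  assumes "finite E" and anti: "\<And>x y. (x, y) \<in> E \<Longrightarrow> (y, x) \<notin> E"
  shows "net_outflow E d v = (\<Sum>k\<in>{k. (v, k) \<in> E \<union> E\<inverse>}. oriented E d (v, k))"
proof -
  have "{k. (v, k) \<in> E \<union> E\<inverse>} = {k. (v, k) \<in> E} \<union> {k. (k, v) \<in> E}" by auto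
  moreover have "{k. (v, k) \<in> E} \<inter> {k. (k, v) \<in> E} = {}" using anti by auto
  moreover have "(\<Sum>k\<in>{k. (v, k) \<in> E}. oriented E d (v, k)) = (\<Sum>k\<in>{k. (v, k) \<in> E}. d (v, k))"
    by (intro sum.cong) (auto simp: oriented_def)
  moreover have "(\<Sum>k\<in>{k. (k, v) \<in> E}. oriented E d (v, k)) = - (\<Sum>k\<in>{k. (k, v) \<in> E}. d (k, v))"
    unfolding sum_negf[symmetric] using anti by (intro sum.cong) (auto simp: oriented_def)
  ultimately show ?thesis
    using finite_neighbours[OF assms(1), of v] by (simp add: net_outflow_def sum.union_disjoint)
qed

lemma net_outflow_add:
  "net_outflow E (\<lambda>e. d e + \<kappa> * g e) v = net_outflow E d v + \<kappa> * net_outflow E g v"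
  by (simp add: net_outflow_def sum.distrib sum_distrib_left algebra_simps)

lemma closed_walk_distinct_fst:
  assumes "pcas u q u" and "distinct (map snd q)"
  shows "distinct (map fst q)" and "fst ` set q = snd ` set q"
proof -
  have "mset (map fst q) = mset (map snd q)"
    using pcas_endpoints_mset[OF assms(1)] by simp
  then show "distinct (map fst q)" "fst ` set q = snd ` set q"
    using assms(2) by (metis mset_eq_imp_distinct_iff, metis list.set_map mset_eq_setD)
qed

text \<open>
  A closed walk without repeated nodes enters a node as often as it leaves it. Hence adding a
  circulation preserves conservation without changing any injection.
\<close>

lemma net_outflow_circulation:
  assumes "finite E" and anti: "\<And>x y. (x, y) \<in> E \<Longrightarrow> (y, x) \<notin> E"
    and "pcas u q u" and "distinct (map snd q)" and sub: "set q \<subseteq> E \<union> E\<inverse>"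
  shows "net_outflow E (circulation q) v = 0"
proof -
  let ?N = "{k. (v, k) \<in> E \<union> E\<inverse>}"
  have fin: "finite ?N" using assms(1) by (intro finite_neighbours) auto
  have inj: "inj_on fst (set q)" "inj_on snd (set q)"
    using closed_walk_distinct_fst[OF assms(3,4)] assms(4) by (auto simp: distinct_map)
  have "card {k. (v, k) \<in> set q} = card {e \<in> set q. fst e = v}"
    by (rule bij_betw_same_card[of "Pair v"]) (auto simp: bij_betw_def inj_on_def image_iff)
  also have "\<dots> = card (fst ` {e \<in> set q. fst e = v})"
    by (rule card_image[symmetric]) (use inj in \<open>auto simp: inj_on_def\<close>)
  also have "fst ` {e \<in> set q. fst e = v} = fst ` set q \<inter> {v}" by auto
  also have "\<dots> = snd ` set q \<inter> {v}"
    using closed_walk_distinct_fst(2)[OF assms(3,4)] by simp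
  also have "\<dots> = snd ` {e \<in> set q. snd e = v}" by auto
  also have "card \<dots> = card {e \<in> set q. snd e = v}"
    by (rule card_image) (use inj in \<open>auto simp: inj_on_def\<close>)
  also have "\<dots> = card {k. (k, v) \<in> set q}"
    by (rule bij_betw_same_card[of fst], rule bij_betw_byWitness[of _ "\<lambda>k. (k, v)"]) auto
  finally have card: "card {k. (v, k) \<in> set q} = card {k. (k, v) \<in> set q}" .
  have sum1: "(\<Sum>k\<in>?N. of_bool ((v, k) \<in> set q)) = real (card {k. (v, k) \<in> set q})"
    "(\<Sum>k\<in>?N. of_bool ((k, v) \<in> set q)) = real (card {k. (k, v) \<in> set q})"
  proof -
    have "?N \<inter> {k. (v, k) \<in> set q} = {k. (v, k) \<in> set q}"
      "?N \<inter> {k. (k, v) \<in> set q} = {k. (k, v) \<in> set q}" using sub by auto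
    with fin show "(\<Sum>k\<in>?N. of_bool ((v, k) \<in> set q)) = real (card {k. (v, k) \<in> set q})"
      "(\<Sum>k\<in>?N. of_bool ((k, v) \<in> set q)) = real (card {k. (k, v) \<in> set q})"
      by (simp_all only: sum_of_bool_eq)
  qed
  have "net_outflow E (circulation q) v = (\<Sum>k\<in>?N. oriented E (circulation q) (v, k))"
    by (rule net_outflow_eq_sum_oriented[OF assms(1) anti])
  also have "\<dots> = (\<Sum>k\<in>?N. circulation q (v, k))"
    by (intro sum.cong) (auto simp: oriented_def circulation_def)
  also have "\<dots> = 0"
    by (simp only: circulation_def swap_simp sum_subtractf sum1 card diff_self)
  finally show ?thesis .
qed

lemma pcas_nth:
  assumes "pcas u q v"
  shows "i < length q \<Longrightarrow> q ! i = ((u # map snd q) ! i, (u # map snd q) ! Suc i)"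
    and "(u # map snd q) ! length q = v"
proof -
  show "i < length q \<Longrightarrow> q ! i = ((u # map snd q) ! i, (u # map snd q) ! Suc i)"
    using assms
  proof (induction q arbitrary: u i)
    case (Cons e q)
    show ?case
    proof (cases i)
      case 0
      then show ?thesis using Cons.prems by (simp add: prod_eq_iff)
    next
      case (Suc j)
      then show ?thesis using Cons.IH[of j "snd e"] Cons.prems by simp
    qed
  qed simp
  show "(u # map snd q) ! length q = v"
    using assms by (induction q arbitrary: u) auto
qed

text \<open>
  A quantity that ignores the direction of an edge can be summed over the edges of the graph that
  a walk uses or along the walk itself, because no edge is used twice. The former is how edges
  enter the penalty, the latter how they enter the analysis of a ring.
\<close>

lemma sum_edges_of_walk:
  fixes g :: "'a \<times> 'a \<Rightarrow> real"
  assumes sub: "set q \<subseteq> E \<union> E\<inverse>"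
    and dist: "distinct (map (\<lambda>(u, v). {u, v}) q)"
    and g_sym: "\<And>x y. g (y, x) = g (x, y)"
    and anti: "\<And>x y. (x, y) \<in> E \<Longrightarrow> (y, x) \<notin> E"
  shows "(\<Sum>e\<in>{e \<in> E. e \<in> set q \<or> prod.swap e \<in> set q}. g e) = sum_list (map g q)"
proof -
  define r where "r e = (if e \<in> E then e else prod.swap e)" for e
  have inj: "inj_on (\<lambda>(u, v). {u, v}) (set q)" and "distinct q"
    using dist by (auto simp: distinct_map)
  have "inj_on r (set q)"
  proof (rule inj_onI)
    fix e e' assume e: "e \<in> set q" "e' \<in> set q" "r e = r e'"
    have unordered: "(case r x of (u, v) \<Rightarrow> {u, v}) = (case x of (u, v) \<Rightarrow> {u, v})" for x
      by (cases x) (auto simp: r_def)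
    show "e = e'"
      by (rule inj_onD[OF inj _ e(1,2)]) (metis unordered e(3))
  qed
  moreover have "r ` set q = {e \<in> E. e \<in> set q \<or> prod.swap e \<in> set q}"
  proof (intro equalityI subsetI)
    fix e assume "e \<in> r ` set q"
    then obtain e' where "e' \<in> set q" "e = r e'" by blast
    then show "e \<in> {e \<in> E. e \<in> set q \<or> prod.swap e \<in> set q}"
      using sub by (cases e') (auto simp: r_def)
  next
    fix e assume e: "e \<in> {e \<in> E. e \<in> set q \<or> prod.swap e \<in> set q}"
    then have "r e = e" "r (prod.swap e) = e"
      using anti by (cases e, auto simp: r_def)+
    with e show "e \<in> r ` set q" by (metis (mono_tags, lifting) image_eqI mem_Collect_eq)
  qed
  ultimately have "(\<Sum>e\<in>{e \<in> E. e \<in> set q \<or> prod.swap e \<in> set q}. g e) = (\<Sum>e\<in>set q. g (r e))"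
    using sum.reindex[of r "set q" g] by simp
  also have "\<dots> = sum g (set q)"
    using g_sym by (intro sum.cong) (auto simp: r_def)
  finally show ?thesis
    using \<open>distinct q\<close> by (simp add: sum_list_distinct_conv_sum_set)
qed

section \<open>Cycles of the flow graph\<close>

lemma parcs_symmetric_flow_graph:
  "parcs (mk_symmetric (with_proj (flow_graph N d))) = edges N \<union> (edges N)\<inverse>"
  by (auto simp: parcs_mk_symmetric flow_graph_def split: if_splits)

lemma undirected_cycle_flow_graph_iff:
  assumes "edges N \<subseteq> nodes N \<times> nodes N"
  shows "undirected_cycle (flow_graph N d) p \<longleftrightarrow>
    p \<noteq> [] \<and> (\<exists>u. pcas u p u) \<and> set p \<subseteq> edges N \<union> (edges N)\<inverse> \<and>
    distinct (map snd p) \<and> distinct (map (\<lambda>(u, v). {u, v}) p)"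
proof -
  have node: "u \<in> nodes N" if "p \<noteq> []" "pcas u p u" "set p \<subseteq> edges N \<union> (edges N)\<inverse>" for u
    using that assms by (cases p) auto
  have tl: "tl (pawalk_verts u p) = map snd p" if "pcas u p u" for u
    using pawalk_verts_conv_snd[OF that] by simp
  show ?thesis
    unfolding undirected_cycle_def pre_digraph.cycle_def pre_digraph.awalk_def
      cas_with_proj_eq awalk_verts_with_proj_eq with_proj_simps parcs_symmetric_flow_graph
    using node by (simp add: flow_graph_def) (metis tl)
qed

lemma ring_inner_degree:
  assumes "ring_rooted_at (flow_graph N d) p m" and "v \<in> fst ` set p" and "v \<noteq> m"
  shows "card {e \<in> edges N \<union> (edges N)\<inverse>. fst e = v} = 2"
  using assms unfolding ring_rooted_at_def cycle_nodes_def out_degree_def out_arcs_def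
    with_proj_simps parcs_symmetric_flow_graph by auto

text \<open>
  A cycle starts at an arbitrary node; the analysis of a ring has to start at its root.
\<close>

lemma rotate_closed_walk:
  assumes "pcas u p u" and "m \<in> fst ` set p"
  obtains q where "mset q = mset p" and "pcas m q m"
proof -
  obtain x where "x \<in> set p" and x: "fst x = m" using assms(2) by auto
  then obtain p1 p2 where p: "p = p1 @ x # p2" by (auto dest: split_list)
  have "pcas u p1 m" "pcas m (x # p2) u"
    using assms(1) x by (auto simp: p pcas_append)
  then have "pcas m ((x # p2) @ p1) m"
    by (subst pcas_append) blast
  moreover have "mset ((x # p2) @ p1) = mset p" by (simp add: p)
  ultimately show ?thesis using that by blast
qed

section \<open>Local modifications of a schedule\<close>

text \<open>
  The direction bits are reset only on \<open>X\<close>, where the flows may change sign; pumps keep theirs.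
\<close>

definition modify_schedule ::
  "'m schedule \<Rightarrow> nat \<Rightarrow> ('m \<times> 'm) set \<Rightarrow> ('m \<times> 'm \<Rightarrow> real) \<Rightarrow> ('m \<Rightarrow> real) \<Rightarrow> 'm schedule" where
  "modify_schedule s t X d h = s
     \<lparr> pressure := (pressure s)(t := h),
       flow := (flow s)(t := d),
       edge_bin := (edge_bin s)(t :=
         (\<lambda>e. if e \<in> X then of_bool (0 \<le> d e) else edge_bin s t e)) \<rparr>"

lemma modify_schedule_simps [simp]:
  "pressure (modify_schedule s t X d h) = (pressure s)(t := h)"
  "flow (modify_schedule s t X d h) = (flow s)(t := d)"
  "edge_bin (modify_schedule s t X d h) =
     (edge_bin s)(t := (\<lambda>e. if e \<in> X then of_bool (0 \<le> d e) else edge_bin s t e))"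
  "injection (modify_schedule s t X d h) = injection s"
  "pump_flow (modify_schedule s t X d h) = pump_flow s"
  "tank_pressure (modify_schedule s t X d h) = tank_pressure s"
  "level (modify_schedule s t X d h) = level s"
  "alpha_bin (modify_schedule s t X d h) = alpha_bin s"
  "beta_bin (modify_schedule s t X d h) = beta_bin s"
  by (simp_all add: modify_schedule_def)

text \<open>
  The set \<open>X\<close> holds the edges whose flow may change, \<open>Y\<close> the nodes whose pressure may change.
  Since \<open>Y\<close> hosts no storage and meets no edge outside \<open>X\<close>, only conservation, the pressure
  limits on \<open>Y\<close> and the drops on \<open>X\<close> are at stake. Injections stay as they are, so tank levels
  are unaffected and the change does not reach other periods.
\<close>

lemma feasible_modify_schedule:
  assumes feas: "feasible N s"
    and "pumps N \<subseteq> edges N" and t: "t \<in> {1..horizon N}"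
    and X: "X \<subseteq> lossy_pipes N"
    and Y: "Y \<inter> (reservoirs N \<union> tanks N) = {}"
    and inc: "\<And>x y. (x, y) \<in> edges N \<Longrightarrow> x \<in> Y \<or> y \<in> Y \<Longrightarrow> (x, y) \<in> X"
    and d_eq: "\<And>e. e \<in> edges N - X \<Longrightarrow> d e = flow s t e"
    and h_eq: "\<And>v. v \<notin> Y \<Longrightarrow> h v = pressure s t v"
    and low: "\<And>v. v \<in> Y \<Longrightarrow> min_pressure N v \<le> h v"
    and net: "\<And>v. net_outflow (edges N) d v = net_outflow (edges N) (flow s t) v"
    and drop: "\<And>x y. (x, y) \<in> X \<Longrightarrow>
      h x - h y = loss_coeff N (x, y) * (d (x, y) * \<bar>d (x, y)\<bar>)"
  shows "feasible N (modify_schedule s t X d h)"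
proof -
  let ?s = "modify_schedule s t X d h"
  have f: "binary_constraints N s t" "conservation N s t" "pump_constraints N s t"
    "reservoir_constraints N s t" "tank_constraints N s t" "pipe_constraints N s t"
    "\<And>m. m \<in> nodes N \<Longrightarrow> min_pressure N m \<le> pressure s t m"
    using feas t unfolding feasible_def by auto
  have outside: "(x, y) \<notin> X \<Longrightarrow> (x, y) \<in> edges N \<Longrightarrow>
      h x = pressure s t x \<and> h y = pressure s t y" for x y
    using inc h_eq by blast
  have fixed_h: "h m = pressure s t m" if "m \<in> reservoirs N \<or> m \<in> tanks N" for m
    using that Y by (intro h_eq) auto
  have inj: "net_injection N ?s t m = net_injection N s t m" for m
    by (simp add: net_injection_def)
  have "binary_constraints N ?s t"
    using f(1) by (auto simp: binary_constraints_def)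
  moreover have "conservation N ?s t"
    using f(2) net unfolding conservation_def inj by (simp add: net_outflow_def)
  moreover have "min_pressure N m \<le> pressure ?s t m" if "m \<in> nodes N" for m
    using f(7)[OF that] low h_eq by (cases "m \<in> Y") auto
  moreover have "pump_constraints N ?s t"
    unfolding pump_constraints_def
  proof (intro ballI, clarify)
    fix m n assume mn: "(m, n) \<in> pumps N"
    then have "(m, n) \<notin> X" "(m, n) \<in> edges N" using X assms(2) by auto
    with outside[of m n] d_eq[of "(m, n)"] f(3) mn
    show "pressure ?s t m - pressure ?s t n = - pump_gain N (m, n) * edge_bin ?s t (m, n) \<and>
        pump_flow_min N (m, n) * edge_bin ?s t (m, n) \<le> pump_flow ?s t (m, n) \<and>
        pump_flow ?s t (m, n) \<le> pump_flow_max N (m, n) * edge_bin ?s t (m, n) \<and>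
        (edge_bin ?s t (m, n) = 1 \<longrightarrow> flow ?s t (m, n) = pump_flow ?s t (m, n))"
      unfolding pump_constraints_def by force
  qed
  moreover have "reservoir_constraints N ?s t"
    using f(4) fixed_h by (simp add: reservoir_constraints_def)
  moreover have "tank_constraints N ?s t"
  proof -
    have "tank_constraints N ?s t = tank_constraints N s t"
      unfolding tank_constraints_def by (intro ball_cong) (simp_all add: fixed_h)
    with f(5) show ?thesis by simp
  qed
  moreover have "pipe_constraints N ?s t"
    unfolding pipe_constraints_def
  proof (intro ballI, clarify)
    fix m n assume mn: "(m, n) \<in> edges N" "(m, n) \<notin> pumps N"
    show "(edge_bin ?s t (m, n) = 1 \<longrightarrow> 0 \<le> flow ?s t (m, n) \<and>
           pressure ?s t m - pressure ?s t n \<ge> loss_coeff N (m, n) * (flow ?s t (m, n))\<^sup>2) \<and>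
        (edge_bin ?s t (m, n) = 0 \<longrightarrow> flow ?s t (m, n) \<le> 0 \<and>
           pressure ?s t n - pressure ?s t m \<ge> loss_coeff N (m, n) * (flow ?s t (m, n))\<^sup>2)"
    proof (cases "(m, n) \<in> X")
      case True
      with drop[OF True] show ?thesis by (auto simp: power2_eq_square)
    next
      case False
      with outside[of m n] d_eq[of "(m, n)"] f(6) mn show ?thesis
        unfolding pipe_constraints_def by force
    qed
  qed
  ultimately have now: "binary_constraints N ?s t \<and> conservation N ?s t \<and>
      (\<forall>m\<in>nodes N. min_pressure N m \<le> pressure ?s t m) \<and> pump_constraints N ?s t \<and>
      reservoir_constraints N ?s t \<and> tank_constraints N ?s t \<and> pipe_constraints N ?s t"
    by blast
  have later: "binary_constraints N ?s t' \<and> conservation N ?s t' \<and>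
      (\<forall>m\<in>nodes N. min_pressure N m \<le> pressure ?s t' m) \<and> pump_constraints N ?s t' \<and>
      reservoir_constraints N ?s t' \<and> tank_constraints N ?s t' \<and> pipe_constraints N ?s t'"
    if "t' \<in> {1..horizon N}" "t' \<noteq> t" for t'
  proof -
    have "binary_constraints N s t' \<and> conservation N s t' \<and>
      (\<forall>m\<in>nodes N. min_pressure N m \<le> pressure s t' m) \<and> pump_constraints N s t' \<and>
      reservoir_constraints N s t' \<and> tank_constraints N s t' \<and> pipe_constraints N s t'"
      using feas that unfolding feasible_def by blast
    moreover have "binary_constraints N ?s t' = binary_constraints N s t'"
      "conservation N ?s t' = conservation N s t'"
      "pump_constraints N ?s t' = pump_constraints N s t'"
      "reservoir_constraints N ?s t' = reservoir_constraints N s t'"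
      "tank_constraints N ?s t' = tank_constraints N s t'"
      "pipe_constraints N ?s t' = pipe_constraints N s t'"
      using that(2) by (simp_all add: binary_constraints_def conservation_def net_injection_def
        pump_constraints_def reservoir_constraints_def tank_constraints_def pipe_constraints_def)
    ultimately show ?thesis using that(2) by simp
  qed
  have all: "binary_constraints N ?s t' \<and> conservation N ?s t' \<and>
      (\<forall>m\<in>nodes N. min_pressure N m \<le> pressure ?s t' m) \<and> pump_constraints N ?s t' \<and>
      reservoir_constraints N ?s t' \<and> tank_constraints N ?s t' \<and> pipe_constraints N ?s t'"
    if "t' \<in> {1..horizon N}" for t'
  proof (cases "t' = t")
    case True
    show ?thesis unfolding True by (rule now)
  qed (rule later[OF that])
  show ?thesis
    unfolding feasible_def
  proof (rule conjI, rule ballI, rule all)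
    show "\<forall>m\<in>tanks N. level ?s 0 m = initial_level N m \<and> level ?s (horizon N) m = initial_level N m"
      using feas by (simp add: feasible_def)
  qed
qed

text \<open>
  A local modification leaves the pump flows alone, so with \<open>lam > 0\<close> the objective compares
  two schedules by the penalty on the modified edges only.
\<close>

lemma minimizer_local_penalty_le:
  fixes lam :: real
  assumes "is_arg_min (\<lambda>s. pumping_cost N (pump_flow s) + lam * pressure_penalty N (pressure s))
      (feasible N) s"
    and feas: "feasible N (modify_schedule s t X d h)"
    and "0 < lam" and t: "t \<in> {1..horizon N}"
    and "finite (edges N)" and X: "X \<subseteq> lossy_pipes N"
    and outside: "\<And>x y. (x, y) \<in> edges N - X \<Longrightarrow> h x = pressure s t x \<and> h y = pressure s t y"
  shows "(\<Sum>(x, y)\<in>X. \<bar>pressure s t x - pressure s t y\<bar>) \<le> (\<Sum>(x, y)\<in>X. \<bar>h x - h y\<bar>)"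
proof -
  let ?g = "\<lambda>h. \<Sum>(x, y)\<in>lossy_pipes N. \<bar>h x - h y\<bar> :: real"
  have split: "?g h' = (\<Sum>(x, y)\<in>lossy_pipes N - X. \<bar>h' x - h' y\<bar>) + (\<Sum>(x, y)\<in>X. \<bar>h' x - h' y\<bar>)"
    for h' using X assms(5) by (intro sum.subset_diff) auto
  have same: "(\<Sum>(x, y)\<in>lossy_pipes N - X. \<bar>h x - h y\<bar>) =
      (\<Sum>(x, y)\<in>lossy_pipes N - X. \<bar>pressure s t x - pressure s t y\<bar>)"
    using outside by (intro sum.cong) auto
  have "pressure_penalty N (pressure s) \<le> pressure_penalty N ((pressure s)(t := h))"
  proof -
    have "pumping_cost N (pump_flow s) + lam * pressure_penalty N (pressure s) \<le>
        pumping_cost N (pump_flow (modify_schedule s t X d h)) +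
        lam * pressure_penalty N (pressure (modify_schedule s t X d h))"
      using assms(1) feas unfolding is_arg_min_def by (meson not_less)
    then show ?thesis using \<open>0 < lam\<close> by simp
  qed
  moreover have "pressure_penalty N h' = ?g (h' t) + (\<Sum>t'\<in>{1..horizon N} - {t}. ?g (h' t'))" for h'
    unfolding pressure_penalty_def using t by (intro sum.remove) auto
  ultimately show ?thesis
    using split[of h] split[of "pressure s t"] same by simp
qed

section \<open>Pressure drops balance along every ring\<close>

definition resistance :: "'m water_network \<Rightarrow> 'm \<times> 'm \<Rightarrow> real" where
  "resistance N e = loss_coeff N (if e \<in> edges N then e else prod.swap e)"

lemma valid_networkD:
  assumes "valid_network N"
  shows "finite (edges N)" and "finite (nodes N)" and "edges N \<subseteq> nodes N \<times> nodes N"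
    and "\<And>x. (x, x) \<notin> edges N"
    and "\<And>x y. (x, y) \<in> edges N \<Longrightarrow> (y, x) \<notin> edges N"
proof -
  interpret pair_digraph "topology N" using assms by (simp add: valid_network_def)
  show "finite (edges N)" by (rule pair_finite_arcs)
  show "finite (nodes N)" by (rule pair_finite_verts)
  show "edges N \<subseteq> nodes N \<times> nodes N" using in_arcsD1 in_arcsD2 by auto
  show "\<And>x. (x, x) \<notin> edges N" using pair_no_loops by fastforce
  show "\<And>x y. (x, y) \<in> edges N \<Longrightarrow> (y, x) \<notin> edges N"
    using assms by (simp add: valid_network_def)
qed

text \<open>
  If the losses did not balance around a ring, circulating the flow \<open>\<kappa>\<close> of
  \<open>unbalanced_ring_improvement\<close> along the ring, with pressures computed from the root, would
  be a feasible schedule with a smaller penalty. The ring hypotheses enter as follows. Degree two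
  and absence of storage make the flow decrease from the root on, since each inner node has a
  consumer demand; they also confine the change to the ring, the pressure of the root being kept.
  The common limit \<open>hmin\<close> is what makes a bound on the lowest new pressure sufficient.
\<close>

lemma ring_drops_balance:
  fixes lam :: real
  assumes valid: "valid_network N"
    and "0 < lam"
    and opt: "is_arg_min
      (\<lambda>s. pumping_cost N (pump_flow s) + lam * pressure_penalty N (pressure s)) (feasible N) s"
    and t: "t \<in> {1..horizon N}"
    and walk: "pcas m q m" and "q \<noteq> []" and sub: "set q \<subseteq> edges N \<union> (edges N)\<inverse>"
    and dist: "distinct (map snd q)" "distinct (map (\<lambda>(u, v). {u, v}) q)"
    and deg: "\<And>v. v \<in> fst ` set q \<Longrightarrow> v \<noteq> m \<Longrightarrow>
      card {e \<in> edges N \<union> (edges N)\<inverse>. fst e = v} = 2"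
    and hmin: "\<And>v. v \<in> fst ` set q \<Longrightarrow> min_pressure N v = hmin"
    and storage: "\<And>v. v \<in> fst ` set q \<Longrightarrow> v \<noteq> m \<Longrightarrow> v \<notin> tanks N \<union> reservoirs N"
    and no_pump: "\<And>u v. (u, v) \<in> set q \<Longrightarrow> (u, v) \<notin> pumps N \<and> (v, u) \<notin> pumps N"
  shows "sum_list (map (\<lambda>e. resistance N e *
    (oriented (edges N) (flow s t) e * \<bar>oriented (edges N) (flow s t) e\<bar>)) q) = 0"
proof (rule ccontr)
  assume unbalanced: "\<not> ?thesis"
  let ?E = "edges N"
  note graph = valid_networkD[OF valid]
  have anti: "(x, y) \<in> ?E \<Longrightarrow> (y, x) \<notin> ?E" for x y by (rule graph(5))
  have feas: "feasible N s" using opt by (simp add: is_arg_min_def)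
  have now: "binary_constraints N s t" "conservation N s t" "pipe_constraints N s t"
    "\<And>v. v \<in> nodes N \<Longrightarrow> min_pressure N v \<le> pressure s t v"
    using feas t unfolding feasible_def by blast+
  define F where "F = oriented ?E (flow s t)"
  define k where "k = length q"
  \<comment> \<open>the nodes along the ring; the root is both \<open>P 0\<close> and \<open>P k\<close>\<close>
  define P where "P i = (m # map snd q) ! i" for i
  have "0 < k" using \<open>q \<noteq> []\<close> by (simp add: k_def)
  have nth: "q ! i = (P i, P (Suc i))" if "i < k" for i
    using pcas_nth(1)[OF walk, of i] that by (simp add: P_def k_def)
  have P0: "P 0 = m" by (simp add: P_def)
  have Pk: "P k = m" using pcas_nth(2)[OF walk] by (simp add: P_def k_def)
  have mem: "(P i, P (Suc i)) \<in> set q" if "i < k" for i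
    using nth[OF that] that nth_mem[of i q] by (simp add: k_def)
  have memE: "\<exists>i<k. x = P i \<and> y = P (Suc i)" if "(x, y) \<in> set q" for x y
    using that nth by (auto simp: in_set_conv_nth k_def)
  have dist_fst: "distinct (map fst q)" by (rule closed_walk_distinct_fst(1)[OF walk dist(1)])
  have P_inj: "inj_on P {..<k}"
  proof (rule inj_onI)
    fix i j assume "i \<in> {..<k}" "j \<in> {..<k}" "P i = P j"
    then show "i = j"
      using nth_eq_iff_index_eq[OF dist_fst, of i j] nth[of i] nth[of j] by (simp add: k_def)
  qed
  have P_img: "fst ` set q = P ` {..<k}"
    using mem memE by force
  have P_ring: "P i \<in> fst ` set q" if "i \<le> k" for i
  proof (cases "i = k")
    case True
    then show ?thesis using P_img P0 Pk \<open>0 < k\<close> by (metis image_eqI lessThan_iff)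
  qed (use that P_img in auto)
  have inner: "P (Suc i) \<noteq> m" if "Suc i < k" for i
    using inj_onD[OF P_inj, of "Suc i" 0] that P0 by auto
  have in_S: "(P i, P (Suc i)) \<in> ?E \<union> ?E\<inverse>" if "i < k" for i
    using mem[OF that] sub by blast
  have ring_nodes: "P i \<in> nodes N" if "i \<le> k" for i
    using P_ring[OF that] sub graph(3) by fastforce
  have edge_eq: "i = j" if "i < k" "j < k" "{P i, P (Suc i)} = {P j, P (Suc j)}" for i j
    using nth_eq_iff_index_eq[OF dist(2), of i j] nth[of i] nth[of j] that by (simp add: k_def)
  have not_back: "(y, x) \<notin> set q" if xy: "(x, y) \<in> set q" for x y
  proof
    assume "(y, x) \<in> set q"
    then obtain i j where ij: "i < k" "x = P i" "y = P (Suc i)" "j < k" "y = P j" "x = P (Suc j)"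
      using memE[OF xy] memE[OF \<open>(y, x) \<in> set q\<close>] by blast
    then have "i = j" by (intro edge_eq) auto
    with ij have "x = y" by simp
    with that sub graph(4) show False by auto
  qed
  have skip: "P i \<noteq> P (Suc (Suc i))" if "Suc i < k" for i
    using edge_eq[of i "Suc i"] that by (auto simp: insert_commute)
  have nbrs: "{e \<in> ?E \<union> ?E\<inverse>. fst e = P (Suc i)} =
      {(P (Suc i), P i), (P (Suc i), P (Suc (Suc i)))}"
    if "Suc i < k" for i
  proof (rule card_subset_eq[symmetric])
    show "card {(P (Suc i), P i), (P (Suc i), P (Suc (Suc i)))} =
        card {e \<in> ?E \<union> ?E\<inverse>. fst e = P (Suc i)}"
      using deg[OF P_ring inner, of i] skip[OF that] that by simp
    show "{(P (Suc i), P i), (P (Suc i), P (Suc (Suc i)))} \<subseteq> {e \<in> ?E \<union> ?E\<inverse>. fst e = P (Suc i)}"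
      using in_S[of i] in_S[of "Suc i"] that by auto
  qed (use graph(1) in auto)
  have F_swap: "F (y, x) = - F (x, y)" for x y
    unfolding F_def by (rule oriented_swap[OF anti])
  define f where "f i = F (q ! i)" for i
  define c where "c i = resistance N (q ! i)" for i
  define H where "H i = pressure s t (P i)" for i
  have pos: "0 < c i" if "i < k" for i
    using in_S[OF that] no_pump[OF mem[OF that]] valid
    unfolding c_def nth[OF that] resistance_def valid_network_def by auto
  have dec: "f (Suc i) \<le> f i" if "Suc i < k" for i
  proof -
    let ?v = "P (Suc i)"
    have v: "?v \<in> nodes N" "?v \<notin> tanks N \<union> reservoirs N"
      using ring_nodes[of "Suc i"] storage[OF P_ring inner, of i] that by simp_all
    have "{w. (?v, w) \<in> ?E \<union> ?E\<inverse>} = snd ` {e \<in> ?E \<union> ?E\<inverse>. fst e = ?v}" by force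
    also have "\<dots> = {P i, P (Suc (Suc i))}" unfolding nbrs[OF that] by simp
    finally have "net_outflow ?E (flow s t) ?v = F (?v, P i) + F (?v, P (Suc (Suc i)))"
      using net_outflow_eq_sum_oriented[OF graph(1) anti, of "flow s t" ?v]
        skip[OF that] by (simp add: F_def)
    moreover have "net_outflow ?E (flow s t) ?v = demand N t ?v"
      using now(2) v unfolding conservation_def net_injection_def net_outflow_def by auto
    moreover have "demand N t ?v \<le> 0"
      using valid v t unfolding valid_network_def by auto
    ultimately show ?thesis
      using F_swap[of ?v "P i"] nth[of i] nth[of "Suc i"] that by (simp add: f_def)
  qed
  have closed: "H k = H 0" by (simp add: H_def P0 Pk)
  have drop: "0 \<le> f i \<and> c i * (f i)\<^sup>2 \<le> H i - H (Suc i) \<or>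
      f i \<le> 0 \<and> c i * (f i)\<^sup>2 \<le> H (Suc i) - H i" if "i < k" for i
  proof -
    have pipe: "0 \<le> flow s t (x, y) \<and>
        loss_coeff N (x, y) * (flow s t (x, y))\<^sup>2 \<le> pressure s t x - pressure s t y \<or>
        flow s t (x, y) \<le> 0 \<and>
        loss_coeff N (x, y) * (flow s t (x, y))\<^sup>2 \<le> pressure s t y - pressure s t x"
      if "(x, y) \<in> lossy_pipes N" for x y
    proof -
      have "edge_bin s t (x, y) = 0 \<or> edge_bin s t (x, y) = 1"
        using now(1) that by (auto simp: binary_constraints_def)
      then show ?thesis
        using now(3) that unfolding pipe_constraints_def by fastforce
    qed
    show ?thesis
    proof (cases "(P i, P (Suc i)) \<in> ?E")
      case True
      with pipe[of "P i" "P (Suc i)"] no_pump[OF mem[OF that]] show ?thesis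
        unfolding f_def c_def nth[OF that] H_def F_def oriented_def resistance_def by simp
    next
      case False
      then have "(P (Suc i), P i) \<in> ?E" using in_S[OF that] by auto
      with False pipe[of "P (Suc i)" "P i"] no_pump[OF mem[OF that]] show ?thesis
        unfolding f_def c_def nth[OF that] H_def F_def oriented_def resistance_def by auto
    qed
  qed
  have low: "hmin \<le> H i" if "i \<le> k" for i
    using now(4)[OF ring_nodes[OF that]] hmin[OF P_ring[OF that]] by (simp add: H_def)
  have "(\<Sum>i<k. c i * (f i * \<bar>f i\<bar>)) \<noteq> 0"
    using unbalanced
    by (simp add: sum_list_sum_nth f_def c_def F_def k_def atLeast0LessThan)
  then obtain \<kappa> where
    \<kappa>: "(\<Sum>i<k. c i * ((f i + \<kappa>) * \<bar>f i + \<kappa>\<bar>)) = 0"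
      "\<And>j. j \<le> k \<Longrightarrow> hmin \<le> H 0 - (\<Sum>i<j. c i * ((f i + \<kappa>) * \<bar>f i + \<kappa>\<bar>))"
      "(\<Sum>i<k. \<bar>c i * ((f i + \<kappa>) * \<bar>f i + \<kappa>\<bar>)\<bar>) < (\<Sum>i<k. \<bar>H i - H (Suc i)\<bar>)"
    using unbalanced_ring_improvement[of k c f H hmin, OF pos dec closed drop low] by blast
  \<comment> \<open>the modified pressures \<open>h\<close> and flows \<open>d\<close>; on the network they differ from the given ones
    only on \<open>Y\<close> and \<open>X\<close>\<close>
  define K where "K j = H 0 - (\<Sum>i<j. c i * ((f i + \<kappa>) * \<bar>f i + \<kappa>\<bar>))" for j
  define h where "h v = (if v \<in> P ` {..<k} then K (the_inv_into {..<k} P v) else pressure s t v)" for v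
  define d where "d = (\<lambda>e. flow s t e + \<kappa> * circulation q e)"
  define X where "X = {e \<in> ?E. e \<in> set q \<or> prod.swap e \<in> set q}"
  define Y where "Y = fst ` set q - {m}"
  have hP: "h (P i) = K i" if "i \<le> k" for i
  proof (cases "i = k")
    case True
    have "h (P 0) = K 0"
      using the_inv_into_f_f[OF P_inj, of 0] \<open>0 < k\<close> by (auto simp: h_def)
    moreover have "K k = K 0" using \<kappa>(1) by (simp add: K_def)
    ultimately show ?thesis using True P0 Pk by simp
  next
    case False
    then show ?thesis using the_inv_into_f_f[OF P_inj, of i] that by (auto simp: h_def)
  qed
  have h_eq: "h v = pressure s t v" if "v \<notin> Y" for v
  proof (cases "v = m")
    case True
    then show ?thesis using hP[of 0] P0 by (simp add: K_def H_def)
  next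
    case False
    with that show ?thesis by (auto simp: h_def Y_def P_img)
  qed
  have X_lossy: "X \<subseteq> lossy_pipes N"
    using no_pump by (auto simp: X_def)
  \<comment> \<open>by the degree condition, all edges at an inner node belong to the ring\<close>
  have inc: "(x, y) \<in> X" if "(x, y) \<in> ?E" "x \<in> Y \<or> y \<in> Y" for x y
  proof -
    have at_Y: "(v, w) \<in> set q \<or> (w, v) \<in> set q" if vw: "(v, w) \<in> ?E \<union> ?E\<inverse>" "v \<in> Y" for v w
    proof -
      obtain i where i: "i < k" "v = P i" using vw(2) by (auto simp: Y_def P_img)
      with vw(2) P0 obtain j where j: "i = Suc j" by (cases i) (auto simp: Y_def)
      have "(v, w) \<in> {e \<in> ?E \<union> ?E\<inverse>. fst e = P (Suc j)}" using vw i j by simp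
      then have "w = P j \<or> w = P (Suc (Suc j))"
        unfolding nbrs[OF i(1)[unfolded j]] by auto
      then show ?thesis using mem[of j] mem[of "Suc j"] i j by auto
    qed
    show ?thesis using at_Y[of x y] at_Y[of y x] that by (auto simp: X_def)
  qed
  have drop_new: "h x - h y = loss_coeff N (x, y) * (d (x, y) * \<bar>d (x, y)\<bar>)"
    if "(x, y) \<in> X" for x y
  proof -
    have step: "h (P i) - h (P (Suc i)) = c i * ((f i + \<kappa>) * \<bar>f i + \<kappa>\<bar>)" if "i < k" for i
      using hP[of i] hP[of "Suc i"] that by (simp add: K_def)
    have xy: "(x, y) \<in> ?E" using that by (simp add: X_def)
    show ?thesis
    proof (cases "(x, y) \<in> set q")
      case True
      then obtain i where i: "i < k" "x = P i" "y = P (Suc i)" using memE by blast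
      have "c i = loss_coeff N (x, y)" "f i + \<kappa> = d (x, y)"
        using xy True not_back[OF True]
        by (simp_all add: c_def f_def nth[OF i(1)] i(2,3)[symmetric] F_def oriented_def
          resistance_def d_def circulation_def)
      then show ?thesis using step[OF i(1)] i by simp
    next
      case False
      then have yx: "(y, x) \<in> set q" using that by (simp add: X_def)
      then obtain i where i: "i < k" "y = P i" "x = P (Suc i)" using memE by blast
      have "c i = loss_coeff N (x, y)" "f i + \<kappa> = - d (x, y)"
        using xy anti[OF xy] yx False
        by (simp_all add: c_def f_def nth[OF i(1)] i(2,3)[symmetric] F_def oriented_def
          resistance_def d_def circulation_def)
      then show ?thesis using step[OF i(1)] i by simp
    qed
  qed
  have new_feas: "feasible N (modify_schedule s t X d h)"
  proof (rule feasible_modify_schedule[where Y = Y])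
    show "pumps N \<subseteq> edges N" using valid by (simp add: valid_network_def)
    show "Y \<inter> (reservoirs N \<union> tanks N) = {}" using storage by (auto simp: Y_def)
    show "d e = flow s t e" if "e \<in> ?E - X" for e
      using that by (auto simp: d_def circulation_def X_def)
    show "min_pressure N v \<le> h v" if vY: "v \<in> Y" for v
    proof -
      obtain i where i: "i < k" "v = P i" using vY by (auto simp: Y_def P_img)
      then have "hmin \<le> h v" using hP[of i] \<kappa>(2)[of i] by (simp add: K_def)
      then show ?thesis using hmin vY by (simp add: Y_def)
    qed
    show "net_outflow ?E d v = net_outflow ?E (flow s t) v" for v
      unfolding d_def net_outflow_add
      using net_outflow_circulation[OF graph(1) anti walk dist(1) sub] by simp
  qed (use feas t X_lossy inc h_eq drop_new in auto)
  have penalty: "(\<Sum>(x, y)\<in>X. \<bar>g x - g y\<bar>) = (\<Sum>i<k. \<bar>g (P i) - g (P (Suc i))\<bar>)" for g :: "'a \<Rightarrow> real"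
  proof -
    have "(\<Sum>(x, y)\<in>X. \<bar>g x - g y\<bar>) = (\<Sum>(x, y)\<leftarrow>q. \<bar>g x - g y\<bar>)"
      unfolding X_def using sub dist(2) by (intro sum_edges_of_walk anti) auto
    also have "\<dots> = (\<Sum>i<k. \<bar>g (P i) - g (P (Suc i))\<bar>)"
      using nth by (simp add: sum_list_sum_nth k_def atLeast0LessThan)
    finally show ?thesis .
  qed
  have "(\<Sum>(x, y)\<in>X. \<bar>pressure s t x - pressure s t y\<bar>) \<le> (\<Sum>(x, y)\<in>X. \<bar>h x - h y\<bar>)"
    by (rule minimizer_local_penalty_le[OF opt new_feas \<open>0 < lam\<close> t graph(1) X_lossy])
      (use inc h_eq in blast)
  also have "\<dots> = (\<Sum>i<k. \<bar>c i * ((f i + \<kappa>) * \<bar>f i + \<kappa>\<bar>)\<bar>)"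
    unfolding penalty using hP by (intro sum.cong) (auto simp: K_def)
  finally show False
    using \<kappa>(3) unfolding penalty H_def by simp
qed

lemma cycle_drops_balance:
  fixes lam :: real
  assumes valid: "valid_network N"
    and "0 < lam"
    and opt: "is_arg_min
      (\<lambda>s. pumping_cost N (pump_flow s) + lam * pressure_penalty N (pressure s)) (feasible N) s"
    and t: "t \<in> {1..horizon N}"
    and ring: "ring_rooted_at (flow_graph N (flow s t)) p m"
    and hmin: "\<forall>v\<in>cycle_nodes p. min_pressure N v = hmin"
    and storage: "\<forall>v\<in>cycle_nodes p - {m}. v \<notin> tanks N \<union> reservoirs N"
    and no_pump: "\<forall>(u, v)\<in>set p. (u, v) \<notin> pumps N \<and> (v, u) \<notin> pumps N"
  shows "sum_list (map (\<lambda>e. resistance N e *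
    (oriented (edges N) (flow s t) e * \<bar>oriented (edges N) (flow s t) e\<bar>)) p) = 0"
proof -
  have "undirected_cycle (flow_graph N (flow s t)) p" and m: "m \<in> fst ` set p"
    using ring by (auto simp: ring_rooted_at_def cycle_nodes_def)
  then obtain u where p: "p \<noteq> []" "pcas u p u" "set p \<subseteq> edges N \<union> (edges N)\<inverse>"
    "distinct (map snd p)" "distinct (map (\<lambda>(u, v). {u, v}) p)"
    using undirected_cycle_flow_graph_iff[OF valid_networkD(3)[OF valid]] by blast
  obtain q where q: "mset q = mset p" "pcas m q m"
    using rotate_closed_walk[OF p(2) m] .
  have map_q: "mset (map g q) = mset (map g p)" for g :: "'a \<times> 'a \<Rightarrow> 'c" using q(1) by simp
  have set_q: "set q = set p" using q(1) by (rule mset_eq_setD)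
  have "sum_list (map (\<lambda>e. resistance N e *
    (oriented (edges N) (flow s t) e * \<bar>oriented (edges N) (flow s t) e\<bar>)) q) = 0"
  proof (rule ring_drops_balance[OF valid \<open>0 < lam\<close> opt t q(2), where hmin = hmin])
    show "q \<noteq> []" using p(1) q(1) by auto
    show "distinct (map snd q)" "distinct (map (\<lambda>(u, v). {u, v}) q)"
      using p(4,5) mset_eq_imp_distinct_iff[OF map_q] by metis+
  qed (use p(3) ring_inner_degree[OF ring] hmin storage no_pump in
      \<open>auto simp: set_q cycle_nodes_def\<close>)
  then show ?thesis
    using map_q by (metis sum_mset_sum_list)
qed

theorem theorem2:
  fixes N :: "'m water_network"
    and lam :: real
    and dp3 d3 :: "nat \<Rightarrow> 'm \<times> 'm \<Rightarrow> real"
    and h3 :: "nat \<Rightarrow> 'm \<Rightarrow> real"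
    and t :: nat
  assumes "valid_network N"
    and "0 < lam"
    and "P3_minimizer N lam dp3 d3 h3"
    and "t \<in> {1..horizon N}"
    and "\<And>p. undirected_cycle (flow_graph N (d3 t)) p \<Longrightarrow>
           \<exists>m. ring_rooted_at (flow_graph N (d3 t)) p m \<and>
               (\<exists>hmin. \<forall>v\<in>cycle_nodes p. min_pressure N v = hmin) \<and>
               (\<forall>v\<in>cycle_nodes p - {m}. v \<notin> tanks N \<union> reservoirs N) \<and>
               (\<forall>(u, v)\<in>set p. (u, v) \<notin> pumps N \<and> (v, u) \<notin> pumps N)"
  shows "consistent_pressures N (dp3 t) (d3 t)"
proof -
  let ?E = "edges N"
  note graph = valid_networkD[OF assms(1)]
  have anti: "(x, y) \<in> ?E \<Longrightarrow> (y, x) \<notin> ?E" for x y by (rule graph(5))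
  obtain s where s: "is_arg_min
      (\<lambda>s. pumping_cost N (pump_flow s) + lam * pressure_penalty N (pressure s)) (feasible N) s"
    and d3: "flow s = d3"
    using assms(3) by (auto simp: P3_minimizer_def)
  \<comment> \<open>Row \<open>(m, n)\<close> of the system reads \<open>sign (m, n) * (h m - h n) = drop_vector (m, n)\<close>.\<close>
  define sign where "sign e = (if 0 \<le> d3 t e then 1 else - 1 :: real)" for e
  define W where "W = oriented ?E (\<lambda>e. sign e * drop_vector N (dp3 t) (d3 t) e)"
  have "\<exists>h. \<forall>(x, y)\<in>?E. h x - h y = W (x, y)"
  proof (rule potential_exists[OF graph(1)])
    show "W (y, x) = - W (x, y)" for x y
      unfolding W_def by (rule oriented_swap[OF anti])
  next
    fix u p
    assume p: "p \<noteq> []" "pcas u p u" "set p \<subseteq> ?E \<union> ?E\<inverse>" "distinct (map snd p)"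
      "distinct (map (\<lambda>(x, y). {x, y}) p)"
    then have "undirected_cycle (flow_graph N (d3 t)) p"
      using undirected_cycle_flow_graph_iff[OF graph(3)] by blast
    then obtain m hmin where ring: "ring_rooted_at (flow_graph N (d3 t)) p m"
      "\<forall>v\<in>cycle_nodes p. min_pressure N v = hmin"
      "\<forall>v\<in>cycle_nodes p - {m}. v \<notin> tanks N \<union> reservoirs N"
      "\<forall>(u, v)\<in>set p. (u, v) \<notin> pumps N \<and> (v, u) \<notin> pumps N"
      using assms(5) by blast
    have "W e = resistance N e * (oriented ?E (d3 t) e * \<bar>oriented ?E (d3 t) e\<bar>)"
      if "e \<in> set p" for e
    proof -
      obtain x y where e: "e = (x, y)" by force
      have "(x, y) \<notin> pumps N" "(y, x) \<notin> pumps N" "(x, y) \<in> ?E \<or> (y, x) \<in> ?E"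
        using that e ring(4) p(3) by auto
      then show ?thesis
        by (auto simp: e W_def oriented_def resistance_def sign_def drop_vector_def power2_eq_square)
    qed
    then have "sum_list (map W p) = sum_list (map (\<lambda>e. resistance N e *
        (oriented ?E (d3 t) e * \<bar>oriented ?E (d3 t) e\<bar>)) p)"
      by (intro arg_cong[where f = sum_list] map_cong) auto
    then show "sum_list (map W p) = 0"
      using cycle_drops_balance[OF assms(1,2) s assms(4), unfolded d3, OF ring] by simp
  qed
  then obtain h where h: "h x - h y = W (x, y)" if "(x, y) \<in> ?E" for x y by auto
  have "(\<Sum>k\<in>nodes N. flow_matrix (d3 t) e k * h k) = drop_vector N (dp3 t) (d3 t) e"
    if "e \<in> ?E" for e
  proof -
    obtain m n where e: "e = (m, n)" by force
    have mn: "m \<in> nodes N" "n \<in> nodes N" "m \<noteq> n" using that e graph(3,4) by auto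
    have "(\<Sum>k\<in>nodes N. flow_matrix (d3 t) e k * h k) =
        (\<Sum>k\<in>{m, n}. flow_matrix (d3 t) e k * h k)"
      using mn graph(2) by (intro sum.mono_neutral_right) (auto simp: e)
    also have "\<dots> = sign e * (h m - h n)"
      using mn(3) by (simp add: e sign_def)
    also have "\<dots> = drop_vector N (dp3 t) (d3 t) e"
      using h[of m n] that by (simp add: e W_def oriented_def sign_def)
    finally show ?thesis .
  qed
  then show ?thesis unfolding consistent_pressures_def by blast
qed

end
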